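(* Let $N\ge 1$ be an integer and let $\alpha\in(0,1)$ be a real number. Suppose the random variable $\xi$ has the Abelian distribution with parameters $\alpha$ and $N$, i.e. $\xi$ takes values in $\{0,1,\dots,N\}$ and $\Pr(\xi=L)=P_{\alpha,N}(L)$ for all $0\le L\le N$, where $P_{\alpha,N}$ is the Abelian probability mass function. Then $$E\xi=\frac{N}{N-(N-1)\alpha}.$$
   Context: For an integer $N\ge 1$ and real $\alpha\in(0,1)$, the Abelian distribution with parameters $\alpha$ and $N$ is the probability distribution on $\{0,1,\dots,N\}$ with mass function $P_{\alpha,N}(0)=0$ and, for integers $1\le L\le N$, $$P_{\alpha,N}(L) = C_{\alpha,N}\binom{N}{L}\left(L\frac{\alpha}{N}\right)^{L-1}\left(1-L\frac{\alpha}{N}\right)^{N-L-1},\qquad C_{\alpha,N}=\frac{1-\alpha}{N-(N-1)\alpha}.$$ For $L=N$ the last factor has exponent $-1$, so it equals $(1-\alpha)^{-1}$. For $L=1$ the factor $\left(L\frac{\alpha}{N}\right)^{L-1}$ equals $1$. $E\xi$ denotes the expected value $\sum_{L=0}^{N}L\,P_{\alpha,N}(L)$. *)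

theory Defs
  imports "HOL-Probability.Probability"
begin

definition abelian_const :: "real \<Rightarrow> nat \<Rightarrow> real" where
  "abelian_const \<alpha> N = (1 - \<alpha>) / (real N - (real N - 1) * \<alpha>)"

text \<open>
  The last exponent is \<open>-1\<close> for \<open>L = N\<close>, hence the integer power there.
\<close>
definition abelian_mass :: "real \<Rightarrow> nat \<Rightarrow> nat \<Rightarrow> real" where
  "abelian_mass \<alpha> N L =
     (if 1 \<le> L \<and> L \<le> N
      then abelian_const \<alpha> N * real (N choose L)
             * (real L * (\<alpha> / real N)) ^ (L - 1)
             * (1 - real L * (\<alpha> / real N)) powi (int N - int L - 1)
      else 0)"

text \<open>
  Measurability into the count space of \<open>{0..N}\<close> also says that \<open>X\<close> takes its values in \<open>{0..N}\<close>.
\<close>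
definition has_abelian_distribution :: "'a measure \<Rightarrow> ('a \<Rightarrow> nat) \<Rightarrow> real \<Rightarrow> nat \<Rightarrow> bool" where
  "has_abelian_distribution M X \<alpha> N \<longleftrightarrow>
     X \<in> M \<rightarrow>\<^sub>M count_space {0..N} \<and>
     (\<forall>L\<in>{0..N}. measure M {\<omega> \<in> space M. X \<omega> = L} = abelian_mass \<alpha> N L)"

end

theory Submission imports Defs begin

text \<open>
  Absorbing the factor \<open>L\<close> of the expectation into the binomial coefficient,
  \<open>L * (N choose L) = N * (N - 1 choose L - 1)\<close>, and reversing the order of summation turns
  \<open>E \<xi>\<close> into an instance of Abel's binomial identity with \<open>x = 1 - \<alpha>\<close>, \<open>y = \<alpha>\<close>,
  \<open>z = \<alpha> / N\<close>, whose right-hand side is \<open>(x + y) ^ (N - 1) = 1\<close>. Abel's identity holds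
  by induction on the exponent: by the induction hypothesis both sides have the same derivative
  in \<open>y\<close>, and they agree at \<open>y = -x\<close>, where the left-hand side of exponent \<open>n\<close> is an
  \<open>n\<close>-th finite difference of a polynomial of degree \<open>n - 1\<close>.
\<close>

lemma alternating_binomial_sum_power_eq_0:
  fixes x z :: "'a :: comm_ring_1"
  assumes "m < n"
  shows "(\<Sum>k\<le>n. (-1) ^ k * of_nat (n choose k) * (x + of_nat k * z) ^ m) = 0"
  using assms
proof (induction m arbitrary: n x)
  case 0
  then show ?case
    using choose_alternating_sum[of n, where 'a = 'a] by simp
next
  case (Suc m)
  then obtain l where n: "n = Suc l" and l: "m < l"
    by (cases n) auto
  \<comment> \<open>Splitting one factor \<open>x + k * z\<close> off the power leaves a part
    carrying \<open>k\<close>. Absorbing that \<open>k\<close> into the binomial coefficient lowers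
    the order from \<open>n\<close> to \<open>l\<close> and moves the base point to
    \<open>x + z\<close>, hence the induction with \<open>n\<close> and \<open>x\<close>
    arbitrary.\<close>
  have absorb: "(\<Sum>k\<le>n. (-1) ^ k * of_nat (n choose k) * (of_nat k * (x + of_nat k * z) ^ m))
      = - (of_nat n * (\<Sum>k\<le>l. (-1) ^ k * of_nat (l choose k) * ((x + z) + of_nat k * z) ^ m))"
  proof -
    have "(-1) ^ Suc k * of_nat (n choose Suc k) * (of_nat (Suc k) * (x + of_nat (Suc k) * z) ^ m)
      = - (of_nat n * ((-1) ^ k * of_nat (l choose k) * ((x + z) + of_nat k * z) ^ m))" for k
    proof -
      have "of_nat (n choose Suc k) * of_nat (Suc k) = (of_nat n * of_nat (l choose k) :: 'a)"
        unfolding n of_nat_mult[symmetric]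
        using binomial_absorption[of k "Suc l"] by (simp only: mult.commute diff_Suc_1)
      then have "(-1) ^ Suc k * (of_nat (n choose Suc k) * of_nat (Suc k)) * w
          = - (of_nat n * ((-1) ^ k * of_nat (l choose k) * w))" for w :: 'a
        by (simp add: mult_ac)
      moreover have "x + of_nat (Suc k) * z = (x + z) + of_nat k * z"
        by (simp add: algebra_simps)
      ultimately show ?thesis
        by (simp only: mult.assoc)
    qed
    then show ?thesis
      unfolding n by (subst sum.atMost_Suc_shift) (simp add: sum_negf sum_distrib_left n)
  qed
  have "(\<Sum>k\<le>n. (-1) ^ k * of_nat (n choose k) * (x + of_nat k * z) ^ Suc m)
      = x * (\<Sum>k\<le>n. (-1) ^ k * of_nat (n choose k) * (x + of_nat k * z) ^ m)
        + z * (\<Sum>k\<le>n. (-1) ^ k * of_nat (n choose k) * (of_nat k * (x + of_nat k * z) ^ m))"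
    unfolding sum_distrib_left sum.distrib[symmetric] by (intro sum.cong) (simp_all add: algebra_simps)
  also have "\<dots> = 0"
    unfolding absorb using Suc.IH[of n x] Suc.IH[of l "x + z"] Suc.prems l by simp
  finally show ?case .
qed

text \<open>The exponent \<open>int k - 1\<close> is negative only at \<open>k = 0\<close>, where
  the base is \<open>x\<close>. So \<open>x \<noteq> 0\<close> keeps every term meaningful, even if
  \<open>x + k * z\<close> vanishes for some \<open>k \<ge> 1\<close>.\<close>

theorem abel_binomial:
  fixes x y z :: real
  assumes "x \<noteq> 0"
  shows "(\<Sum>k\<le>n. real (n choose k) * x * (x + real k * z) powi (int k - 1) * (y - real k * z) ^ (n - k))
    = (x + y) ^ n"
proof (induction n arbitrary: y)
  case 0
  then show ?case
    using assms by (simp add: power_int_minus)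
next
  case (Suc n)
  \<comment> \<open>\<open>c k\<close> collects the factors free of \<open>y\<close>, which are
    constants under differentiation.\<close>
  define c where "c k = x * (x + real k * z) powi (int k - 1)" for k
  define F where "F y = (\<Sum>k\<le>Suc n. real (Suc n choose k) * c k * (y - real k * z) ^ (Suc n - k))
    - (x + y) ^ Suc n" for y
  have "(F has_real_derivative 0) (at y)" for y
  proof -
    \<comment> \<open>This also covers \<open>k = Suc n\<close>: there \<open>Suc n - k\<close> and
      \<open>n choose k\<close> are both 0, so the extra top term drops out and the sum of exponent
      \<open>n\<close> remains.\<close>
    have summand: "real (Suc n choose k) * c k * (real (Suc n - k) * (y - real k * z) ^ (n - k))
        = real (Suc n) * (real (n choose k) * x * (x + real k * z) powi (int k - 1)
            * (y - real k * z) ^ (n - k))" for k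
    proof -
      have "real (Suc n choose k) * real (Suc n - k) = real (Suc n) * real (n choose k)"
        unfolding of_nat_mult[symmetric] using binomial_absorb_comp[of "Suc n" k]
        by (simp add: mult.commute del: of_nat_mult)
      then have "(real (Suc n choose k) * real (Suc n - k)) * (c k * (y - real k * z) ^ (n - k))
          = (real (Suc n) * real (n choose k)) * (c k * (y - real k * z) ^ (n - k))"
        by (rule arg_cong)
      then show ?thesis
        unfolding c_def by (simp only: mult_ac)
    qed
    have power: "((\<lambda>y. (y - a) ^ m) has_real_derivative real m * (y - a) ^ (m - 1)) (at y)"
      for a :: real and m
      by (auto intro!: derivative_eq_intros)
    have "(F has_real_derivative
        (\<Sum>k\<le>Suc n. real (Suc n choose k) * c k * (real (Suc n - k) * (y - real k * z) ^ (n - k)))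
        - real (Suc n) * (x + y) ^ n) (at y)"
      unfolding F_def
    proof (intro DERIV_diff DERIV_sum DERIV_cmult)
      show "((\<lambda>y. (y - real k * z) ^ (Suc n - k)) has_real_derivative
          real (Suc n - k) * (y - real k * z) ^ (n - k)) (at y)" for k
        using power[of "real k * z" "Suc n - k"] by simp
      show "((\<lambda>y. (x + y) ^ Suc n) has_real_derivative real (Suc n) * (x + y) ^ n) (at y)"
        using power[of "- x" "Suc n"] by (simp add: add.commute)
    qed
    also have "(\<Sum>k\<le>Suc n. real (Suc n choose k) * c k * (real (Suc n - k) * (y - real k * z) ^ (n - k)))
        = real (Suc n) * (x + y) ^ n"
      unfolding summand Suc.IH[of y, symmetric] sum_distrib_left[symmetric] by simp
    finally show ?thesis
      by simp
  qed
  then have "F y = F (- x)"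
    by (intro DERIV_isconst_all) blast
  also have "F (- x) = (\<Sum>k\<le>Suc n. (- 1) ^ Suc n * x *
      ((- 1) ^ k * real (Suc n choose k) * (x + real k * z) ^ n))"
  proof -
    have "real (Suc n choose k) * c k * (- x - real k * z) ^ (Suc n - k)
        = (- 1) ^ Suc n * x * ((- 1) ^ k * real (Suc n choose k) * (x + real k * z) ^ n)"
      if k: "k \<le> Suc n" for k
    proof -
      \<comment> \<open>At \<open>y = -x\<close> the two powers have the same base up to sign. For
        \<open>k = 0\<close> the exponents \<open>-1\<close> and \<open>Suc n\<close> combine
        because \<open>x \<noteq> 0\<close>; for \<open>k \<ge> 1\<close> both are natural numbers
        with sum \<open>n\<close>.\<close>
      have collapse: "(x + real k * z) powi (int k - 1) * (x + real k * z) ^ (Suc n - k)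
          = (x + real k * z) ^ n"
      proof (cases k)
        case 0
        then show ?thesis
          using assms by (simp add: power_int_minus)
      next
        case (Suc j)
        then show ?thesis
          using k by (simp add: power_int_def flip: power_add)
      qed
      have sign: "(- x - real k * z) ^ (Suc n - k)
          = (- 1) ^ Suc n * (- 1) ^ k * (x + real k * z) ^ (Suc n - k)"
      proof -
        have "(- x - real k * z) ^ (Suc n - k) = (- 1) ^ (Suc n - k) * (x + real k * z) ^ (Suc n - k)"
          unfolding power_mult_distrib[symmetric] by simp
        also have "(- 1 :: real) ^ (Suc n - k) = (- 1) ^ Suc n * (- 1) ^ k"
          using k by (simp add: minus_one_power_iff)
        finally show ?thesis .
      qed
      show ?thesis
        unfolding c_def sign collapse[symmetric] by (simp only: mult_ac)
    qed
    then have "(\<Sum>k\<le>Suc n. real (Suc n choose k) * c k * (- x - real k * z) ^ (Suc n - k))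
        = (\<Sum>k\<le>Suc n. (- 1) ^ Suc n * x * ((- 1) ^ k * real (Suc n choose k) * (x + real k * z) ^ n))"
      by (intro sum.cong) simp_all
    then show ?thesis
      unfolding F_def by (simp del: sum.atMost_Suc)
  qed
  also have "\<dots> = 0"
    unfolding sum_distrib_left[symmetric]
    using alternating_binomial_sum_power_eq_0[of n "Suc n" x z] by simp
  finally show ?case
    unfolding F_def c_def by (simp add: mult_ac)
qed

text \<open>The denominator \<open>1 - \<alpha>\<close> compensates for the factor
  \<open>x = 1 - \<alpha>\<close> that every term of Abel's identity carries.\<close>

lemma sum_abelian_mass:
  assumes "N \<ge> 1" and "\<alpha> < 1"
  shows "(\<Sum>L\<le>N. real L * abelian_mass \<alpha> N L) = abelian_const \<alpha> N * (real N / (1 - \<alpha>))"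
proof -
  obtain n where N: "N = Suc n"
    using assms(1) by (cases N) auto
  define z where "z = \<alpha> / real N"
  have Nz: "real N * z = \<alpha>"
    using N by (simp add: z_def)
  \<comment> \<open>With \<open>L = N - k\<close> the exponent \<open>N - L - 1\<close> becomes
    \<open>k - 1\<close>, so the exceptional case \<open>L = N\<close> matches the term
    \<open>k = 0\<close> of Abel's identity. As \<open>N * z = \<alpha>\<close>, the two bases
    become \<open>\<alpha> - k * z\<close> and \<open>(1 - \<alpha>) + k * z\<close>.\<close>
  have summand: "real (Suc (n - k)) * abelian_mass \<alpha> N (Suc (n - k))
      = abelian_const \<alpha> N * real N / (1 - \<alpha>) * (real (n choose k) * (1 - \<alpha>)
          * ((1 - \<alpha>) + real k * z) powi (int k - 1) * (\<alpha> - real k * z) ^ (n - k))"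
    if k: "k \<le> n" for k
  proof -
    have absorb: "real (Suc (n - k)) * real (N choose Suc (n - k)) = real N * real (n choose k)"
      unfolding N of_nat_mult[symmetric]
      using binomial_absorption[of "n - k" "Suc n"] binomial_symmetric[OF k]
      by (simp del: of_nat_mult)
    have "real (Suc (n - k)) * z = \<alpha> - real k * z"
      unfolding Nz[symmetric] N using k by (simp add: of_nat_diff algebra_simps)
    moreover have "abelian_mass \<alpha> N (Suc (n - k)) = abelian_const \<alpha> N * real (N choose Suc (n - k))
        * (real (Suc (n - k)) * z) ^ (n - k) * (1 - real (Suc (n - k)) * z) powi (int k - 1)"
      using k by (simp add: abelian_mass_def z_def N of_nat_diff)
    ultimately have "real (Suc (n - k)) * abelian_mass \<alpha> N (Suc (n - k))
        = abelian_const \<alpha> N * (real (Suc (n - k)) * real (N choose Suc (n - k)))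
          * (\<alpha> - real k * z) ^ (n - k) * (1 - (\<alpha> - real k * z)) powi (int k - 1)"
      by (simp only: mult_ac)
    also have "real (Suc (n - k)) * real (N choose Suc (n - k)) = real N * real (n choose k)"
      by (fact absorb)
    also have "1 - (\<alpha> - real k * z) = (1 - \<alpha>) + real k * z"
      by simp
    finally show ?thesis
      using assms(2) by simp
  qed
  have "(\<Sum>L\<le>N. real L * abelian_mass \<alpha> N L) = (\<Sum>k\<le>n. real (Suc k) * abelian_mass \<alpha> N (Suc k))"
    unfolding N by (subst sum.atMost_Suc_shift) simp
  also have "\<dots> = (\<Sum>k\<le>n. real (Suc (n - k)) * abelian_mass \<alpha> N (Suc (n - k)))"
    by (rule sum.reindex_bij_witness[of _ "\<lambda>k. n - k" "\<lambda>k. n - k"]) auto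
  also have "\<dots> = (\<Sum>k\<le>n. abelian_const \<alpha> N * real N / (1 - \<alpha>) * (real (n choose k) * (1 - \<alpha>)
      * ((1 - \<alpha>) + real k * z) powi (int k - 1) * (\<alpha> - real k * z) ^ (n - k)))"
    by (rule sum.cong[OF refl], rule summand) simp
  also have "\<dots> = abelian_const \<alpha> N * real N / (1 - \<alpha>) * ((1 - \<alpha>) + \<alpha>) ^ n"
    using assms(2) unfolding sum_distrib_left[symmetric] by (subst abel_binomial) auto
  finally show ?thesis
    by simp
qed

theorem theorem3p1:
  fixes M :: "'a measure" and \<xi> :: "'a \<Rightarrow> nat" and N :: nat and \<alpha> :: real
  assumes "N \<ge> 1" and "0 < \<alpha>" and "\<alpha> < 1"
    and "prob_space M"
    and "has_abelian_distribution M \<xi> \<alpha> N"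
  shows "prob_space.expectation M (\<lambda>\<omega>. real (\<xi> \<omega>)) = real N / (real N - (real N - 1) * \<alpha>)"
proof -
  interpret prob_space M
    by fact
  have meas: "\<xi> \<in> M \<rightarrow>\<^sub>M count_space {0..N}"
    and mass: "\<And>L. L \<le> N \<Longrightarrow> prob {\<omega> \<in> space M. \<xi> \<omega> = L} = abelian_mass \<alpha> N L"
    using assms(5) by (auto simp: has_abelian_distribution_def)
  have range: "\<xi> \<omega> \<le> N" if "\<omega> \<in> space M" for \<omega>
    using measurable_space[OF meas that] by simp
  have sets [measurable]: "{\<omega> \<in> space M. \<xi> \<omega> = L} \<in> events" for L
  proof -
    \<comment> \<open>Only subsets of \<open>{0..N}\<close> are measurable in the target space; the
      intersection makes the argument uniform in \<open>L\<close>, the level set being empty for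
      \<open>L > N\<close>.\<close>
    have "\<xi> -` ({L} \<inter> {0..N}) \<inter> space M \<in> events"
      by (rule measurable_sets[OF meas]) simp
    also have "\<xi> -` ({L} \<inter> {0..N}) \<inter> space M = {\<omega> \<in> space M. \<xi> \<omega> = L}"
      using range by auto
    finally show ?thesis .
  qed
  \<comment> \<open>As \<open>\<xi>\<close> takes finitely many values, it is a finite combination
    of indicators of its level sets, which can be integrated termwise.\<close>
  have "expectation (\<lambda>\<omega>. real (\<xi> \<omega>))
      = expectation (\<lambda>\<omega>. \<Sum>L\<le>N. real L * indicator {\<omega> \<in> space M. \<xi> \<omega> = L} \<omega>)"
    using range by (intro Bochner_Integration.integral_cong)
      (simp_all add: indicator_def if_distrib sum.delta cong: if_cong)
  also have "\<dots> = (\<Sum>L\<le>N. real L * prob {\<omega> \<in> space M. \<xi> \<omega> = L})"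
    by (subst Bochner_Integration.integral_sum) (auto simp: sets less_top[symmetric])
  also have "\<dots> = (\<Sum>L\<le>N. real L * abelian_mass \<alpha> N L)"
    by (simp add: mass)
  also have "\<dots> = abelian_const \<alpha> N * (real N / (1 - \<alpha>))"
    using assms(1,3) by (rule sum_abelian_mass)
  also have "\<dots> = real N / (real N - (real N - 1) * \<alpha>)"
    using assms(3) by (simp add: abelian_const_def)
  finally show ?thesis .
qed

end
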